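(* Let $p,q,r\in\mathbb{N}$ and $\mathbb{X}\subseteq\mathbb{R}^p$. If $f_{[1]}\in\mathcal{L}_q^{*}(\mathbb{X})$ and $f_{[2]}\in\mathcal{L}_r^{*}(\mathbb{X})$, then $f_{[12]}\in\mathcal{L}_{q+r}^{*}(\mathbb{X})$, where $f_{[12]}=f_{[1]}f_{[2]}$, that is, $f_{[12]}(\boldsymbol{y}|\boldsymbol{x})=f_{[1]}(\boldsymbol{y}_{[1]}|\boldsymbol{x})\,f_{[2]}(\boldsymbol{y}_{[2]}|\boldsymbol{x})$ for $\boldsymbol{x}\in\mathbb{X}$ and $\boldsymbol{y}^\top=(\boldsymbol{y}_{[1]}^\top,\boldsymbol{y}_{[2]}^\top)$ with $\boldsymbol{y}_{[1]}\in\mathbb{R}^q$, $\boldsymbol{y}_{[2]}\in\mathbb{R}^r$.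
   Context: For $d\in\mathbb{N}$, $\boldsymbol{\mu}\in\mathbb{R}^d$ and symmetric positive-definite $\boldsymbol{\Sigma}\in\mathbb{R}^{d\times d}$, $\phi_d(\boldsymbol{y};\boldsymbol{\mu},\boldsymbol{\Sigma})=|2\pi\boldsymbol{\Sigma}|^{-1/2}\exp[-\tfrac12(\boldsymbol{y}-\boldsymbol{\mu})^\top\boldsymbol{\Sigma}^{-1}(\boldsymbol{y}-\boldsymbol{\mu})]$ is the $d$-dimensional Gaussian density. For $d\in\mathbb{N}$, $\mathcal{L}_d^{*}(\mathbb{X})$ is the class of all conditional densities of the form \[ f(\boldsymbol{y}|\boldsymbol{x})=\sum_{z=1}^n\frac{\pi_z\,\phi_p(\boldsymbol{x};\boldsymbol{\mu}_z,\boldsymbol{\Sigma}_z)\,\phi_d(\boldsymbol{y};\boldsymbol{a}_z,\mathbf{C}_z)}{\sum_{\zeta=1}^n\pi_\zeta\,\phi_p(\boldsymbol{x};\boldsymbol{\mu}_\zeta,\boldsymbol{\Sigma}_\zeta)},\qquad \boldsymbol{x}\in\mathbb{X},\ \boldsymbol{y}\in\mathbb{R}^d, \] where $n\in\mathbb{N}$ (positive integers; $n$ may vary with $f$), $\pi_z>0$ with $\sum_{z=1}^n\pi_z=1$, $\boldsymbol{\mu}_z\in\mathbb{R}^p$, $\boldsymbol{\Sigma}_z\in\mathbb{R}^{p\times p}$ symmetric positive-definite, $\boldsymbol{a}_z\in\mathbb{R}^d$, and $\mathbf{C}_z\in\mathbb{R}^{d\times d}$ symmetric positive-definite, for $z\in\{1,\dots,n\}$.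 *)

theory Defs
  imports "HOL-Analysis.Analysis"
begin

definition sym_pos_def :: "real ^ 'n ^ 'n \<Rightarrow> bool" where
  "sym_pos_def S \<longleftrightarrow> transpose S = S \<and> (\<forall>x. x \<noteq> 0 \<longrightarrow> x \<bullet> (S *v x) > 0)"

definition gauss_density :: "real ^ 'n \<Rightarrow> real ^ 'n ^ 'n \<Rightarrow> real ^ 'n \<Rightarrow> real" where
  "gauss_density \<mu> S y =
     det ((2 * pi) *\<^sub>R S) powr (- 1 / 2) * exp (- (1 / 2) * ((y - \<mu>) \<bullet> (matrix_inv S *v (y - \<mu>))))"

text \<open>
  A conditional density \<open>f(y|x)\<close> is written \<open>f y x\<close>. It is a function on \<open>x \<in> X\<close> only, so
  membership in the class does not constrain its values for \<open>x\<close> outside \<open>X\<close>.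
\<close>

definition gated_gauss_class :: "(real ^ 'p) set \<Rightarrow> (real ^ 'd \<Rightarrow> real ^ 'p \<Rightarrow> real) set" where
  "gated_gauss_class X =
     {f. \<exists>(n::nat) (w :: nat \<Rightarrow> real) (\<mu> :: nat \<Rightarrow> real ^ 'p) (S :: nat \<Rightarrow> real ^ 'p ^ 'p)
           (a :: nat \<Rightarrow> real ^ 'd) (C :: nat \<Rightarrow> real ^ 'd ^ 'd).
        n \<ge> 1 \<and>
        (\<forall>z\<in>{1..n}. w z > 0 \<and> sym_pos_def (S z) \<and> sym_pos_def (C z)) \<and>
        (\<Sum>z=1..n. w z) = 1 \<and>
        (\<forall>x\<in>X. \<forall>y. f y x =
           (\<Sum>z=1..n. w z * gauss_density (\<mu> z) (S z) x * gauss_density (a z) (C z) y /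
              (\<Sum>\<zeta>=1..n. w \<zeta> * gauss_density (\<mu> \<zeta>) (S \<zeta>) x)))}"

text \<open>
  \<open>\<real>\<^sup>q\<^sup>+\<^sup>r\<close> is \<open>real ^ ('q + 'r)\<close>: the \<open>Inl\<close> coordinates form the first block of a vector
  and the \<open>Inr\<close> coordinates the second.
\<close>

definition fst_block :: "real ^ ('q::finite + 'r::finite) \<Rightarrow> real ^ 'q" where
  "fst_block y = (\<chi> i. y $ Inl i)"

definition snd_block :: "real ^ ('q::finite + 'r::finite) \<Rightarrow> real ^ 'r" where
  "snd_block y = (\<chi> j. y $ Inr j)"

definition cond_prod ::
  "(real ^ 'q \<Rightarrow> real ^ 'p \<Rightarrow> real) \<Rightarrow> (real ^ 'r \<Rightarrow> real ^ 'p \<Rightarrow> real)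
     \<Rightarrow> real ^ ('q::finite + 'r::finite) \<Rightarrow> real ^ 'p \<Rightarrow> real" where
  "cond_prod f1 f2 y x = f1 (fst_block y) x * f2 (snd_block y) x"

end

theory Submission
  imports Defs
begin

text \<open>
  For each \<open>x\<close>, the product of two Gaussian densities in \<open>x\<close> is, by completing the square, a
  positive constant times a Gaussian density in \<open>x\<close>, while the product of the densities in the two
  blocks of \<open>y\<close> is the Gaussian density with block diagonal covariance. Expanding the product of
  the two mixtures thus gives a mixture over pairs of indices, whose weights need only be
  normalised.
\<close>

section \<open>Matrices\<close>

lemma matrix_inv_cancel:
  fixes A :: "real ^ 'n ^ 'n"
  assumes "invertible A"
  shows "matrix_inv A ** A = mat 1" "A ** matrix_inv A = mat 1"
proof -
  have "A ** matrix_inv A = mat 1 \<and> matrix_inv A ** A = mat 1"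
    using assms unfolding invertible_def matrix_inv_def by (rule someI_ex)
  then show "matrix_inv A ** A = mat 1" "A ** matrix_inv A = mat 1" by simp_all
qed

text \<open>A one-sided inverse of a square matrix is two-sided, so a single product identity
  determines the inverse.\<close>

lemma matrix_inv_eqI:
  fixes A B :: "real ^ 'n ^ 'n"
  assumes "A ** B = mat 1"
  shows "matrix_inv A = B"
proof -
  have "invertible A"
    using assms by (auto simp: invertible_right_inverse)
  then have "matrix_inv A = matrix_inv A ** (A ** B)"
    using assms by simp
  also have "\<dots> = B"
    using \<open>invertible A\<close> by (simp add: matrix_mul_assoc matrix_inv_cancel)
  finally show ?thesis .
qed

text \<open>Leaving \<open>f\<close> general lets one determinant computation serve both
  \<open>Inl\<close> and \<open>Inr\<close>. The ones on the diagonal outside the range leave the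
  determinant of the block unchanged.\<close>

definition embed_matrix :: "('n \<Rightarrow> 'm) \<Rightarrow> real ^ 'n ^ 'n \<Rightarrow> real ^ 'm ^ 'm" where
  "embed_matrix f A =
     (\<chi> i j. if i \<in> range f \<and> j \<in> range f then A $ inv f i $ inv f j else of_bool (i = j))"

text \<open>In the Leibniz expansion, a permutation moving an index outside \<open>range f\<close>
  picks up a zero entry there. The others permute \<open>range f\<close> and correspond to the
  permutations of the smaller index type by conjugation with \<open>f\<close>, which preserves
  signs.\<close>

lemma det_embed_matrix:
  fixes f :: "'n::finite \<Rightarrow> 'm::finite"
  assumes f: "inj f"
  shows "det (embed_matrix f A) = det A"
proof -
  let ?E = "embed_matrix f A"
  let ?t = "\<lambda>p. of_int (sign p) * (\<Prod>i\<in>UNIV. ?E $ i $ p i)"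
  have bij: "bij_betw f UNIV (range f)" "bij_betw (inv f) (range f) UNIV"
    using f by (simp_all add: inj_imp_bij_betw_inv inj_on_imp_bij_betw)
  have zero: "?t p = 0" if p: "p permutes UNIV" "\<not> p permutes range f" for p
  proof -
    obtain i where "i \<notin> range f" "p i \<noteq> i"
      using p permutes_superset[of p UNIV "range f"] by blast
    then have "?E $ i $ p i = 0"
      by (simp add: embed_matrix_def)
    then show ?thesis
      by (auto intro!: prod_zero)
  qed
  have "det ?E = (\<Sum>p | p permutes range f. ?t p)"
    unfolding det_def
    by (rule sum.mono_neutral_right) (auto simp: zero intro: permutes_subset)
  also have "\<dots> = (\<Sum>p | p permutes UNIV. of_int (sign p) * (\<Prod>i\<in>UNIV. A $ i $ p i))"
  proof (rule sum.reindex_bij_witness[where i = "map_permutation UNIV f"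
        and j = "map_permutation (range f) (inv f)"])
    fix p assume "p \<in> {p. p permutes range f}"
    then have p: "p permutes range f" by simp
    let ?q = "map_permutation (range f) (inv f) p"
    show "map_permutation UNIV f ?q = p"
      by (rule map_permutation_compose_inv[OF bij(2) p]) (auto simp: f)
    show "?q \<in> {p. p permutes UNIV}"
      using map_permutation_permutes[OF bij(2) p] by simp
    \<comment> \<open>\<open>?q\<close> is \<open>p\<close> conjugated by \<open>f\<close>; this
      identity matches the entries of \<open>A\<close> with those of \<open>?E\<close> inside the
      range.\<close>
    have q: "f (?q i) = p (f i)" for i
      using map_permutation_apply[of "inv f" "range f" "f i" p] p f bij(2)
      by (auto simp: bij_betw_def permutes_in_image f_inv_into_f)
    \<comment> \<open>Outside the range \<open>p\<close> fixes every index, so the omitted factors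
      are diagonal ones.\<close>
    have "(\<Prod>i\<in>UNIV. ?E $ i $ p i) = (\<Prod>i\<in>range f. ?E $ i $ p i)"
      by (rule prod.mono_neutral_right)
        (use p in \<open>auto simp: embed_matrix_def permutes_not_in\<close>)
    also have "\<dots> = (\<Prod>i\<in>UNIV. A $ i $ ?q i)"
      using f by (simp add: prod.reindex embed_matrix_def flip: q)
    moreover have "sign ?q = sign p"
      using bij(2) p by (intro sign_map_permutation) (auto simp: bij_betw_def)
    ultimately show "of_int (sign ?q) * (\<Prod>i\<in>UNIV. A $ i $ ?q i) = ?t p"
      by simp
  next
    fix p :: "'n \<Rightarrow> 'n" assume "p \<in> {p. p permutes UNIV}"
    then have p: "p permutes UNIV" by simp
    show "map_permutation (range f) (inv f) (map_permutation UNIV f p) = p"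
      by (rule map_permutation_compose_inv[OF bij(1) p]) (auto simp: f)
    show "map_permutation UNIV f p \<in> {p. p permutes range f}"
      using map_permutation_permutes[OF bij(1) p] by simp
  qed
  also have "\<dots> = det A"
    by (simp add: det_def)
  finally show ?thesis .
qed

lemma sum_UNIV_Plus:
  fixes g :: "'a::finite + 'b::finite \<Rightarrow> real"
  shows "(\<Sum>i\<in>UNIV. g i) = (\<Sum>i\<in>UNIV. g (Inl i)) + (\<Sum>j\<in>UNIV. g (Inr j))"
  using sum.Plus[of "UNIV :: 'a set" "UNIV :: 'b set" g] by simp

definition block_diag :: "real ^ 'q ^ 'q \<Rightarrow> real ^ 'r ^ 'r \<Rightarrow> real ^ ('q + 'r) ^ ('q + 'r)" where
  "block_diag A B =
     (\<chi> i j. case (i, j) of (Inl i, Inl j) \<Rightarrow> A $ i $ j | (Inr i, Inr j) \<Rightarrow> B $ i $ j | _ \<Rightarrow> 0)"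

lemma block_diag_nth [simp]:
  "block_diag A B $ Inl i $ Inl j = A $ i $ j"
  "block_diag A B $ Inr k $ Inr l = B $ k $ l"
  "block_diag A B $ Inl i $ Inr l = 0"
  "block_diag A B $ Inr k $ Inl j = 0"
  by (simp_all add: block_diag_def)

lemma block_diag_eqI:
  fixes M N :: "real ^ ('q::finite + 'r::finite) ^ ('q + 'r)"
  assumes "\<And>i j. M $ Inl i $ Inl j = N $ Inl i $ Inl j" "\<And>i j. M $ Inl i $ Inr j = N $ Inl i $ Inr j"
    "\<And>i j. M $ Inr i $ Inl j = N $ Inr i $ Inl j" "\<And>i j. M $ Inr i $ Inr j = N $ Inr i $ Inr j"
  shows "M = N"
proof -
  have "M $ k $ l = N $ k $ l" for k l
    by (cases k; cases l) (simp_all add: assms)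
  then show ?thesis
    by (simp add: vec_eq_iff)
qed

text \<open>Factor the matrix as diag(A, 1) times diag(1, B) and use multiplicativity of the
  determinant.\<close>

lemma det_block_diag:
  fixes A :: "real ^ 'q::finite ^ 'q" and B :: "real ^ 'r::finite ^ 'r"
  shows "det (block_diag A B) = det A * det B"
proof -
  have "block_diag A B = embed_matrix Inl A ** embed_matrix Inr B"
    by (rule block_diag_eqI)
      (simp_all add: matrix_matrix_mult_def embed_matrix_def sum_UNIV_Plus image_iff
        of_bool_def if_distrib[of "\<lambda>c. _ * c"] if_distrib[of "\<lambda>c. c * _"] sum.delta sum.delta' cong: if_cong)
  then show ?thesis
    by (simp add: det_mul det_embed_matrix)
qed

lemma block_diag_mult:
  fixes A A' :: "real ^ 'q::finite ^ 'q" and B B' :: "real ^ 'r::finite ^ 'r"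
  shows "block_diag A B ** block_diag A' B' = block_diag (A ** A') (B ** B')"
  by (rule block_diag_eqI) (simp_all add: matrix_matrix_mult_def sum_UNIV_Plus)

lemma block_diag_mat_1: "block_diag (mat 1) (mat 1) = mat 1"
  by (rule block_diag_eqI) (simp_all add: mat_def)

lemma block_diag_scaleR: "block_diag (c *\<^sub>R A) (c *\<^sub>R B) = c *\<^sub>R block_diag A B"
  by (rule block_diag_eqI) simp_all

lemma inner_block_diag:
  "y \<bullet> (block_diag A B *v y) =
     fst_block y \<bullet> (A *v fst_block y) + snd_block y \<bullet> (B *v snd_block y)"
  by (simp add: inner_vec_def matrix_vector_mult_def sum_UNIV_Plus fst_block_def snd_block_def)

section \<open>Positive definite matrices\<close>

lemma sym_pos_def_transpose: "sym_pos_def S \<Longrightarrow> transpose S = S"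
  by (simp add: sym_pos_def_def)

lemma sym_pos_def_inner_pos: "sym_pos_def S \<Longrightarrow> x \<noteq> 0 \<Longrightarrow> x \<bullet> (S *v x) > 0"
  by (simp add: sym_pos_def_def)

lemma sym_pos_def_inner_nonneg: "sym_pos_def S \<Longrightarrow> x \<bullet> (S *v x) \<ge> 0"
  by (cases "x = 0") (simp_all add: sym_pos_def_inner_pos less_imp_le)

text \<open>The kernel is trivial: the quadratic form would vanish at any nonzero kernel
  vector.\<close>

lemma sym_pos_def_invertible:
  assumes "sym_pos_def S"
  shows "invertible S"
proof -
  have "\<forall>x. S *v x = 0 \<longrightarrow> x = 0"
    using sym_pos_def_inner_pos[OF assms] by (metis inner_zero_right less_irrefl)
  then show ?thesis
    by (simp add: invertible_left_inverse matrix_left_invertible_ker)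
qed

lemma sym_matrix_inner:
  fixes S :: "real ^ 'n ^ 'n"
  assumes "transpose S = S"
  shows "x \<bullet> (S *v y) = y \<bullet> (S *v x)"
  using dot_lmul_matrix[of x S y] vector_transpose_matrix[of x S] assms
  by (simp add: inner_commute)

text \<open>With \<open>z = matrix_inv S *v x\<close>, the form of the inverse at \<open>x\<close>
  is the form of \<open>S\<close> at \<open>z\<close>.\<close>

lemma sym_pos_def_matrix_inv:
  assumes S: "sym_pos_def S"
  shows "sym_pos_def (matrix_inv S)"
proof -
  note inv = matrix_inv_cancel[OF sym_pos_def_invertible[OF S]]
  \<comment> \<open>Transposing the inverse identity shows that the transposed inverse is again a
    right inverse of \<open>S\<close>, and uniqueness gives symmetry.\<close>
  have "S ** transpose (matrix_inv S) = transpose (matrix_inv S ** S)"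
    using S by (simp add: matrix_transpose_mul sym_pos_def_transpose)
  then have "S ** transpose (matrix_inv S) = mat 1"
    by (simp add: inv)
  then have sym: "transpose (matrix_inv S) = matrix_inv S"
    by (rule matrix_inv_eqI[symmetric])
  moreover have "x \<bullet> (matrix_inv S *v x) > 0" if "x \<noteq> 0" for x
  proof -
    let ?z = "matrix_inv S *v x"
    have x: "S *v ?z = x"
      by (simp add: matrix_vector_mul_assoc inv)
    then have "?z \<noteq> 0"
      using that by (metis matrix_vector_mult_0_right)
    then have "?z \<bullet> (S *v ?z) > 0"
      using S by (rule sym_pos_def_inner_pos[rotated])
    then show ?thesis
      by (simp only: x inner_commute)
  qed
  ultimately show ?thesis
    by (simp add: sym_pos_def_def)
qed

lemma sym_pos_def_add:
  assumes "sym_pos_def S" "sym_pos_def T"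
  shows "sym_pos_def (S + T)"
proof -
  have "transpose (S + T) = transpose S + transpose T"
    by (simp add: transpose_def vec_eq_iff)
  with assms show ?thesis
    by (simp add: sym_pos_def_def matrix_vector_mult_add_rdistrib inner_add_right add_pos_pos)
qed

text \<open>The quadratic form is the sum of those of the blocks, and a nonzero vector has a nonzero
  block, which makes one summand positive.\<close>

lemma sym_pos_def_block_diag:
  fixes A :: "real ^ 'q::finite ^ 'q" and B :: "real ^ 'r::finite ^ 'r"
  assumes A: "sym_pos_def A" and B: "sym_pos_def B"
  shows "sym_pos_def (block_diag A B)"
  unfolding sym_pos_def_def
proof (intro conjI allI impI)
  have "transpose (block_diag A B) = block_diag (transpose A) (transpose B)"
    by (rule block_diag_eqI) (simp_all add: transpose_def)
  with A B show "transpose (block_diag A B) = block_diag A B"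
    by (simp add: sym_pos_def_transpose)
next
  fix y :: "real ^ ('q + 'r)" assume "y \<noteq> 0"
  have "fst_block y \<noteq> 0 \<or> snd_block y \<noteq> 0"
  proof (rule ccontr)
    assume "\<not> ?thesis"
    then have "y $ Inl i = 0" "y $ Inr j = 0" for i j
      by (simp_all add: fst_block_def snd_block_def vec_eq_iff)
    then have "y $ k = 0" for k
      by (cases k) simp_all
    with \<open>y \<noteq> 0\<close> show False by (simp add: vec_eq_iff)
  qed
  then show "y \<bullet> (block_diag A B *v y) > 0"
    unfolding inner_block_diag
    using sym_pos_def_inner_nonneg[OF A] sym_pos_def_inner_nonneg[OF B]
      sym_pos_def_inner_pos[OF A] sym_pos_def_inner_pos[OF B]
    by (blast intro: add_pos_nonneg add_nonneg_pos)
qed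

section \<open>Products of Gaussian densities\<close>

text \<open>Since \<open>powr\<close> is positive at every nonzero base, this makes the normalising
  factor of the density positive.\<close>

lemma det_scaled_pos_def_neq_0:
  assumes "sym_pos_def S"
  shows "det ((2 * pi) *\<^sub>R S) \<noteq> 0"
  using scalar_invertible[of "2 * pi" S] sym_pos_def_invertible[OF assms]
  by (simp add: invertible_det_nz)

lemma gauss_density_pos: "sym_pos_def S \<Longrightarrow> gauss_density \<mu> S y > 0"
  by (simp add: gauss_density_def det_scaled_pos_def_neq_0)

text \<open>Inverse, quadratic form and determinant all split along the blocks; the factor
  \<open>2 * pi\<close> is moved into each block before the determinant is taken.\<close>

lemma gauss_density_block_diag:
  fixes A :: "real ^ 'q::finite ^ 'q" and B :: "real ^ 'r::finite ^ 'r"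
  assumes A: "sym_pos_def A" and B: "sym_pos_def B"
  shows "gauss_density a A (fst_block y) * gauss_density b B (snd_block y) =
    gauss_density (\<chi> i. case i of Inl i \<Rightarrow> a $ i | Inr j \<Rightarrow> b $ j) (block_diag A B) y"
proof -
  define m where "m = (\<chi> i. case i of Inl i \<Rightarrow> a $ i | Inr j \<Rightarrow> b $ j)"
  have blocks: "fst_block (y - m) = fst_block y - a" "snd_block (y - m) = snd_block y - b"
    by (simp_all add: m_def fst_block_def snd_block_def vec_eq_iff)
  have "matrix_inv (block_diag A B) = block_diag (matrix_inv A) (matrix_inv B)"
    by (rule matrix_inv_eqI)
      (simp add: block_diag_mult matrix_inv_cancel A B sym_pos_def_invertible block_diag_mat_1)
  then show ?thesis
    unfolding m_def[symmetric]
    by (simp add: gauss_density_def inner_block_diag blocks det_block_diag powr_mult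
        mult_exp_exp add_divide_distrib flip: block_diag_scaleR)
qed

text \<open>The inverse covariances add: \<open>U\<close> is the inverse of their sum and
  \<open>m\<close> the mean weighted by them. The rest of the exponent does not depend on
  \<open>x\<close> and goes into \<open>K\<close>, with the ratio of normalising factors.\<close>

lemma gauss_density_mult:
  assumes S: "sym_pos_def S" and T: "sym_pos_def T"
  obtains K m U where "K > 0" "sym_pos_def U"
    "\<And>x. gauss_density \<mu> S x * gauss_density \<nu> T x = K * gauss_density m U x"
proof -
  define P Q where "P = matrix_inv S" and "Q = matrix_inv T"
  have PQ: "sym_pos_def P" "sym_pos_def Q"
    by (simp_all add: P_def Q_def S T sym_pos_def_matrix_inv)
  then have R: "sym_pos_def (P + Q)"
    by (rule sym_pos_def_add)
  define U where "U = matrix_inv (P + Q)"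
  have U: "sym_pos_def U"
    by (simp add: U_def R sym_pos_def_matrix_inv)
  note inv = matrix_inv_cancel[OF sym_pos_def_invertible[OF R]]
  have invU: "matrix_inv U = P + Q"
    by (rule matrix_inv_eqI) (simp add: U_def inv)
  \<comment> \<open>\<open>m\<close> solves the linear system that makes the terms linear in
    \<open>x\<close> agree on both sides of the completed square.\<close>
  define m where "m = U *v (P *v \<mu> + Q *v \<nu>)"
  have m: "(P + Q) *v m = P *v \<mu> + Q *v \<nu>"
    by (simp add: m_def U_def matrix_vector_mul_assoc inv)
  \<comment> \<open>Symmetry of \<open>M\<close> merges the two cross terms into one.\<close>
  have expand: "(x - c) \<bullet> (M *v (x - c)) = x \<bullet> (M *v x) - 2 * (x \<bullet> (M *v c)) + c \<bullet> (M *v c)"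
    if "sym_pos_def M" for M :: "real ^ 'a ^ 'a" and x c
    using sym_matrix_inner[OF sym_pos_def_transpose[OF that], of c x]
    by (simp add: matrix_vector_mult_diff_distrib inner_diff_left inner_diff_right)
  define c where "c = \<mu> \<bullet> (P *v \<mu>) + \<nu> \<bullet> (Q *v \<nu>) - m \<bullet> ((P + Q) *v m)"
  have square: "(x - \<mu>) \<bullet> (P *v (x - \<mu>)) + (x - \<nu>) \<bullet> (Q *v (x - \<nu>)) =
      (x - m) \<bullet> ((P + Q) *v (x - m)) + c" for x
    unfolding expand[OF PQ(1)] expand[OF PQ(2)] expand[OF R] m c_def
    by (simp add: matrix_vector_mult_add_rdistrib inner_add_right)
  define d where "d M = det ((2 * pi) *\<^sub>R M) powr (- 1 / 2)" for M :: "real ^ 'a ^ 'a"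
  have d: "d S > 0" "d T > 0" "d U > 0"
    by (simp_all add: d_def S T U det_scaled_pos_def_neq_0)
  define K where "K = d S * d T / d U * exp (- (1 / 2) * c)"
  have "gauss_density \<mu> S x * gauss_density \<nu> T x = K * gauss_density m U x" for x
  proof -
    have "gauss_density \<mu> S x * gauss_density \<nu> T x = d S * d T *
        exp (- (1 / 2) * ((x - \<mu>) \<bullet> (P *v (x - \<mu>)) + (x - \<nu>) \<bullet> (Q *v (x - \<nu>))))"
      by (simp add: gauss_density_def d_def P_def Q_def mult_exp_exp add_divide_distrib)
    also have "\<dots> = d S * d T *
        (exp (- (1 / 2) * ((x - m) \<bullet> ((P + Q) *v (x - m)))) * exp (- (1 / 2) * c))"
      unfolding square by (simp only: distrib_left exp_add)
    also have "\<dots> = K * (d U * exp (- (1 / 2) * ((x - m) \<bullet> ((P + Q) *v (x - m)))))"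
      using d by (simp add: K_def)
    finally show ?thesis
      by (simp only: gauss_density_def d_def invU)
  qed
  moreover have "K > 0"
    using d by (simp add: K_def)
  ultimately show ?thesis
    using that U by blast
qed

section \<open>Closure under products\<close>

text \<open>A membership criterion with an arbitrary finite index set and unnormalised weights.
  Dividing all weights by their total scales numerator and denominator alike, so the quotient is
  unchanged.\<close>

lemma gated_gauss_classI:
  fixes I :: "'i set" and f :: "real ^ 'd \<Rightarrow> real ^ 'p \<Rightarrow> real"
  assumes fin: "finite I" "I \<noteq> {}"
    and pos: "\<And>i. i \<in> I \<Longrightarrow> w i > 0"
    and spd: "\<And>i. i \<in> I \<Longrightarrow> sym_pos_def (S i)" "\<And>i. i \<in> I \<Longrightarrow> sym_pos_def (C i)"
    and f: "\<And>x y. x \<in> X \<Longrightarrow> f y x =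
      (\<Sum>i\<in>I. w i * gauss_density (\<mu> i) (S i) x * gauss_density (a i) (C i) y) /
      (\<Sum>i\<in>I. w i * gauss_density (\<mu> i) (S i) x)"
  shows "f \<in> gated_gauss_class X"
proof -
  \<comment> \<open>The enumeration starts at 1 to match the index range in the class.\<close>
  obtain h where h: "bij_betw h {1..card I} I"
    using ex_bij_betw_nat_finite_1[OF fin(1)] by blast
  have hI: "h z \<in> I" if "z \<in> {1..card I}" for z
    using h that by (auto simp: bij_betw_def)
  have reindex: "(\<Sum>z=1..card I. g (h z)) = (\<Sum>i\<in>I. g i)" for g :: "'i \<Rightarrow> real"
    using h by (rule sum.reindex_bij_betw)
  define W where "W = (\<Sum>i\<in>I. w i)"
  have W: "W > 0"
    unfolding W_def using fin pos by (rule sum_pos)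
  have "f y x = (\<Sum>z=1..card I. w (h z) / W * gauss_density (\<mu> (h z)) (S (h z)) x *
      gauss_density (a (h z)) (C (h z)) y /
      (\<Sum>\<zeta>=1..card I. w (h \<zeta>) / W * gauss_density (\<mu> (h \<zeta>)) (S (h \<zeta>)) x))"
    if "x \<in> X" for x y
  proof -
    define D where "D = (\<Sum>i\<in>I. w i * gauss_density (\<mu> i) (S i) x)"
    have D: "(\<Sum>\<zeta>=1..card I. w (h \<zeta>) / W * gauss_density (\<mu> (h \<zeta>)) (S (h \<zeta>)) x) = D / W"
      unfolding reindex[of "\<lambda>i. w i / W * gauss_density (\<mu> i) (S i) x"] D_def
      by (simp add: sum_divide_distrib)
    show ?thesis
      unfolding D reindex[of "\<lambda>i. w i / W * gauss_density (\<mu> i) (S i) x *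
          gauss_density (a i) (C i) y / (D / W)"] f[OF that] D_def[symmetric]
      using W by (simp add: sum_divide_distrib)
  qed
  moreover have "(\<Sum>z=1..card I. w (h z) / W) = 1"
    unfolding reindex[of "\<lambda>i. w i / W"] using W
    by (simp add: W_def flip: sum_divide_distrib)
  moreover have "card I \<ge> 1"
    using fin by (simp add: Suc_le_eq card_gt_0_iff)
  moreover have "\<forall>z\<in>{1..card I}. w (h z) / W > 0 \<and> sym_pos_def (S (h z)) \<and> sym_pos_def (C (h z))"
    using hI pos spd W by simp
  ultimately show ?thesis
    unfolding gated_gauss_class_def mem_Collect_eq
    by (intro exI[of _ "card I"] exI[of _ "\<lambda>z. w (h z) / W"] exI[of _ "\<lambda>z. \<mu> (h z)"]
        exI[of _ "\<lambda>z. S (h z)"] exI[of _ "\<lambda>z. a (h z)"] exI[of _ "\<lambda>z. C (h z)"]) blast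
qed

theorem lemma3:
  fixes X :: "(real ^ 'p) set"
    and f1 :: "real ^ 'q \<Rightarrow> real ^ 'p \<Rightarrow> real"
    and f2 :: "real ^ 'r \<Rightarrow> real ^ 'p \<Rightarrow> real"
  assumes "f1 \<in> gated_gauss_class X"
    and "f2 \<in> gated_gauss_class X"
  shows "cond_prod f1 f2 \<in> gated_gauss_class X"
proof -
  obtain n1 w1 \<mu>1 and S1 :: "nat \<Rightarrow> real ^ 'p ^ 'p" and a1 and C1 :: "nat \<Rightarrow> real ^ 'q ^ 'q"
    where n1: "n1 \<ge> 1"
      and p1: "\<And>z. z \<in> {1..n1} \<Longrightarrow> w1 z > 0 \<and> sym_pos_def (S1 z) \<and> sym_pos_def (C1 z)"
      and f1: "\<And>x y. x \<in> X \<Longrightarrow> f1 y x =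
        (\<Sum>z=1..n1. w1 z * gauss_density (\<mu>1 z) (S1 z) x * gauss_density (a1 z) (C1 z) y /
          (\<Sum>\<zeta>=1..n1. w1 \<zeta> * gauss_density (\<mu>1 \<zeta>) (S1 \<zeta>) x))"
    using assms(1) unfolding gated_gauss_class_def by blast
  obtain n2 w2 \<mu>2 and S2 :: "nat \<Rightarrow> real ^ 'p ^ 'p" and a2 and C2 :: "nat \<Rightarrow> real ^ 'r ^ 'r"
    where n2: "n2 \<ge> 1"
      and p2: "\<And>z. z \<in> {1..n2} \<Longrightarrow> w2 z > 0 \<and> sym_pos_def (S2 z) \<and> sym_pos_def (C2 z)"
      and f2: "\<And>x y. x \<in> X \<Longrightarrow> f2 y x =
        (\<Sum>z=1..n2. w2 z * gauss_density (\<mu>2 z) (S2 z) x * gauss_density (a2 z) (C2 z) y /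
          (\<Sum>\<zeta>=1..n2. w2 \<zeta> * gauss_density (\<mu>2 \<zeta>) (S2 \<zeta>) x))"
    using assms(2) unfolding gated_gauss_class_def by blast
  \<comment> \<open>Each component of the product mixture comes from one component of either
    factor.\<close>
  define I where "I = {1..n1} \<times> {1..n2}"
  have "\<forall>p\<in>I. \<exists>K m U. K > 0 \<and> sym_pos_def U \<and>
      (\<forall>x. gauss_density (\<mu>1 (fst p)) (S1 (fst p)) x * gauss_density (\<mu>2 (snd p)) (S2 (snd p)) x =
        K * gauss_density m U x)"
  proof
    fix p assume "p \<in> I"
    then have "sym_pos_def (S1 (fst p))" "sym_pos_def (S2 (snd p))"
      using p1 p2 by (auto simp: I_def)
    then show "\<exists>K m U. K > 0 \<and> sym_pos_def U \<and>
      (\<forall>x. gauss_density (\<mu>1 (fst p)) (S1 (fst p)) x * gauss_density (\<mu>2 (snd p)) (S2 (snd p)) x =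
        K * gauss_density m U x)"
      by (rule gauss_density_mult) blast
  qed
  then obtain K m U where KU: "\<And>p. p \<in> I \<Longrightarrow> K p > 0 \<and> sym_pos_def (U p)"
    and gx: "\<And>p x. p \<in> I \<Longrightarrow> gauss_density (\<mu>1 (fst p)) (S1 (fst p)) x *
        gauss_density (\<mu>2 (snd p)) (S2 (snd p)) x = K p * gauss_density (m p) (U p) x"
    by metis
  \<comment> \<open>The constant \<open>K p\<close> from the product of the two gating densities is
    absorbed into the weight. These weights need not sum to one.\<close>
  define w where "w p = w1 (fst p) * w2 (snd p) * K p" for p
  define a :: "nat \<times> nat \<Rightarrow> real ^ ('q + 'r)" where
    "a p = (\<chi> i. case i of Inl i \<Rightarrow> a1 (fst p) $ i | Inr j \<Rightarrow> a2 (snd p) $ j)" for p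
  define C where "C p = block_diag (C1 (fst p)) (C2 (snd p))" for p
  show ?thesis
  proof (rule gated_gauss_classI[where I = I and w = w and \<mu> = m and S = U and a = a and C = C])
    show "finite I" "I \<noteq> {}"
      using n1 n2 by (auto simp: I_def)
    fix p assume p: "p \<in> I"
    then have p': "fst p \<in> {1..n1}" "snd p \<in> {1..n2}"
      by (auto simp: I_def)
    show "w p > 0" "sym_pos_def (U p)" "sym_pos_def (C p)"
      using p1[OF p'(1)] p2[OF p'(2)] KU[OF p] by (simp_all add: w_def C_def sym_pos_def_block_diag)
  next
    fix x and y :: "real ^ ('q + 'r)" assume x: "x \<in> X"
    let ?g1 = "\<lambda>i. w1 i * gauss_density (\<mu>1 i) (S1 i) x"
    let ?g2 = "\<lambda>i. w2 i * gauss_density (\<mu>2 i) (S2 i) x"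
    let ?h1 = "\<lambda>i. gauss_density (a1 i) (C1 i) (fst_block y)"
    let ?h2 = "\<lambda>i. gauss_density (a2 i) (C2 i) (snd_block y)"
    have g: "w p * gauss_density (m p) (U p) x = ?g1 (fst p) * ?g2 (snd p)" if "p \<in> I" for p
      using gx[OF that, of x] by (simp add: w_def mult_ac)
    have h: "gauss_density (a p) (C p) y = ?h1 (fst p) * ?h2 (snd p)" if "p \<in> I" for p
      using that p1[of "fst p"] p2[of "snd p"] unfolding a_def C_def
      by (subst gauss_density_block_diag) (auto simp: I_def)
    \<comment> \<open>By distributivity a product of two sums is one sum over pairs; it is applied
      to the gating denominators and to the numerators.\<close>
    have prod: "(\<Sum>i=1..n1. s i) * (\<Sum>j=1..n2. t j) = (\<Sum>p\<in>I. s (fst p) * t (snd p))"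
      for s t :: "nat \<Rightarrow> real"
      by (simp add: I_def sum_product sum.cartesian_product split_def)
    have D: "(\<Sum>p\<in>I. w p * gauss_density (m p) (U p) x) = (\<Sum>i=1..n1. ?g1 i) * (\<Sum>j=1..n2. ?g2 j)"
      unfolding prod by (rule sum.cong) (simp_all only: g)
    have N: "(\<Sum>p\<in>I. w p * gauss_density (m p) (U p) x * gauss_density (a p) (C p) y) =
        (\<Sum>i=1..n1. ?g1 i * ?h1 i) * (\<Sum>j=1..n2. ?g2 j * ?h2 j)"
      unfolding prod by (rule sum.cong) (simp_all only: g h mult_ac)
    show "cond_prod f1 f2 y x =
        (\<Sum>p\<in>I. w p * gauss_density (m p) (U p) x * gauss_density (a p) (C p) y) /
        (\<Sum>p\<in>I. w p * gauss_density (m p) (U p) x)"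
      \<comment> \<open>In each factor the common denominator is pulled out of the sum, leaving a
        product of two quotients to compare with the quotient of products.\<close>
      unfolding D N cond_prod_def f1[OF x] f2[OF x]
      by (simp add: sum_divide_distrib[symmetric])
  qed
qed

end
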